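(* Let $1\le p<\infty$, let $\mu$ be a positive Borel measure on $\mathbb{D}$ satisfying the standing axiom on $D^p_\mu$ stated in the context, and let $\varphi$ be an analytic self-map of $\mathbb{D}$. If the composition operator $C_\varphi$ is bounded from $\mathcal{B}$ to $D^p_\mu$, then it is also compact (from $\mathcal{B}$ to $D^p_\mu$).
   Context: $\mathbb{D}=\{z\in\mathbb{C}:|z|<1\}$; $\mathcal{H}(\mathbb{D})$ is the set of analytic functions on $\mathbb{D}$. A self-map of $\mathbb{D}$ is an analytic function $\varphi:\mathbb{D}\to\mathbb{D}$, and $C_\varphi(f)=f\circ\varphi$ for $f\in\mathcal{H}(\mathbb{D})$. The Bloch space $\mathcal{B}$ is the Banach space of all $f\in\mathcal{H}(\mathbb{D})$ with $\|f\|_{\mathcal{B}}=|f(0)|+\sup_{z\in\mathbb{D}}(1-|z|^2)|f'(z)|<\infty$. For a positive Borel measure $\mu$ on $\mathbb{D}$ and $1\le p<\infty$, $D^p_\mu$ is the space of all $f\in\mathcal{H}(\mathbb{D})$ with $\|f\|_{D^p_\mu}^p=|f(0)|^p+\int_{\mathbb{D}}|f'|^p\,d\mu<\infty$. Standing axiom: $D^p_\mu$ is a Banach space and the point-evaluation functionals $f\mapsto f(\zeta)$ are uniformly bounded on $D^p_\mu$ for $\zeta$ in compact subsets of $\mathbb{D}$ (for each compact $K\subset\mathbb{D}$ there is $C_K$ with $|f(\zeta)|\le C_K\|f\|_{D^p_\mu}$ for all $\zeta\in K$, $f\in D^p_\mu$). *)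

theory Defs
  imports "HOL-Complex_Analysis.Complex_Analysis" "HOL-Library.Function_Algebras"
begin

section \<open>Normed spaces of complex functions\<close>

definition normed_space_on ::
    "('a \<Rightarrow> complex) set \<Rightarrow> (('a \<Rightarrow> complex) \<Rightarrow> real) \<Rightarrow> bool" where
  "normed_space_on V N \<longleftrightarrow>
     0 \<in> V \<and>
     (\<forall>f\<in>V. \<forall>g\<in>V. f + g \<in> V) \<and>
     (\<forall>c. \<forall>f\<in>V. (\<lambda>z. c * f z) \<in> V) \<and>
     (\<forall>f\<in>V. 0 \<le> N f) \<and>
     (\<forall>f\<in>V. N f = 0 \<longleftrightarrow> f = 0) \<and>
     (\<forall>c. \<forall>f\<in>V. N (\<lambda>z. c * f z) = cmod c * N f) \<and>
     (\<forall>f\<in>V. \<forall>g\<in>V. N (f + g) \<le> N f + N g)"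

text \<open>
  The locale \<^locale>\<open>Metric_space\<close> requires non-negativity and symmetry of the distance on the
  whole type, hence the value 0 outside the carrier; it does not affect the metric on the carrier.
\<close>

definition norm_dist ::
    "('a \<Rightarrow> complex) set \<Rightarrow> (('a \<Rightarrow> complex) \<Rightarrow> real) \<Rightarrow> ('a \<Rightarrow> complex) \<Rightarrow> ('a \<Rightarrow> complex) \<Rightarrow> real" where
  "norm_dist V N f g = (if f \<in> V \<and> g \<in> V then N (f - g) else 0)"

lemma Metric_space_norm_dist:
  assumes "normed_space_on V N"
  shows "Metric_space V (norm_dist V N)"
proof -
  have neg: "(\<lambda>z. (-1) * h z) = - h" for h :: "'a \<Rightarrow> complex"
    by (simp add: fun_eq_iff)
  have add: "f + g \<in> V" "N (f + g) \<le> N f + N g" if "f \<in> V" "g \<in> V" for f g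
    using assms that by (simp_all add: normed_space_on_def)
  have scale: "(\<lambda>z. c * f z) \<in> V" "N (\<lambda>z. c * f z) = cmod c * N f" if "f \<in> V" for c f
    using assms that by (simp_all add: normed_space_on_def)
  have minus: "- f \<in> V" "N (- f) = N f" if "f \<in> V" for f
    using scale[OF that, of "-1"] unfolding neg by simp_all
  have diff: "f - g \<in> V" if "f \<in> V" "g \<in> V" for f g
    using add(1)[OF that(1) minus(1)[OF that(2)]] by simp
  have nonneg: "0 \<le> N f" "N f = 0 \<longleftrightarrow> f = 0" if "f \<in> V" for f
    using assms that by (simp_all add: normed_space_on_def)
  show ?thesis
  proof
    show "0 \<le> norm_dist V N f g" for f g
      by (simp add: norm_dist_def diff nonneg)
    show "norm_dist V N f g = norm_dist V N g f" for f g
      using minus(2)[OF diff, of f g] by (simp add: norm_dist_def)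
    show "norm_dist V N f g = 0 \<longleftrightarrow> f = g" if "f \<in> V" "g \<in> V" for f g
      using that by (simp add: norm_dist_def diff nonneg)
    show "norm_dist V N f h \<le> norm_dist V N f g + norm_dist V N g h"
      if "f \<in> V" "g \<in> V" "h \<in> V" for f g h
      using add(2)[OF diff[OF that(1,2)] diff[OF that(2,3)]] that by (simp add: norm_dist_def)
  qed
qed

definition banach_space_on ::
    "('a \<Rightarrow> complex) set \<Rightarrow> (('a \<Rightarrow> complex) \<Rightarrow> real) \<Rightarrow> bool" where
  "banach_space_on V N \<longleftrightarrow>
     normed_space_on V N \<and> Metric_space.mcomplete V (norm_dist V N)"

definition linear_operator_on ::
    "('a \<Rightarrow> complex) set \<Rightarrow> ('b \<Rightarrow> complex) set \<Rightarrow> (('a \<Rightarrow> complex) \<Rightarrow> ('b \<Rightarrow> complex)) \<Rightarrow> bool" where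
  "linear_operator_on V W T \<longleftrightarrow>
     T ` V \<subseteq> W \<and>
     (\<forall>f\<in>V. \<forall>g\<in>V. T (f + g) = T f + T g) \<and>
     (\<forall>c. \<forall>f\<in>V. T (\<lambda>z. c * f z) = (\<lambda>z. c * T f z))"

definition bounded_operator_on ::
    "('a \<Rightarrow> complex) set \<Rightarrow> (('a \<Rightarrow> complex) \<Rightarrow> real) \<Rightarrow>
     ('b \<Rightarrow> complex) set \<Rightarrow> (('b \<Rightarrow> complex) \<Rightarrow> real) \<Rightarrow>
     (('a \<Rightarrow> complex) \<Rightarrow> ('b \<Rightarrow> complex)) \<Rightarrow> bool" where
  "bounded_operator_on V N W M T \<longleftrightarrow>
     linear_operator_on V W T \<and> (\<exists>C. \<forall>f\<in>V. M (T f) \<le> C * N f)"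

definition compact_operator_on ::
    "('a \<Rightarrow> complex) set \<Rightarrow> (('a \<Rightarrow> complex) \<Rightarrow> real) \<Rightarrow>
     ('b \<Rightarrow> complex) set \<Rightarrow> (('b \<Rightarrow> complex) \<Rightarrow> real) \<Rightarrow>
     (('a \<Rightarrow> complex) \<Rightarrow> ('b \<Rightarrow> complex)) \<Rightarrow> bool" where
  "compact_operator_on V N W M T \<longleftrightarrow>
     linear_operator_on V W T \<and>
     (let X = Metric_space.mtopology W (norm_dist W M)
      in compactin X (X closure_of (T ` {f \<in> V. N f \<le> 1})))"

section \<open>Spaces of analytic functions on the unit disc\<close>

text \<open>
  An analytic function on the disc is represented by its extension by 0 to the whole plane, so that
  equality of representatives is equality on the disc. The derivative is only ever taken at points
  of the (open) disc, where the extension plays no role.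
\<close>

abbreviation unit_disc :: "complex set" where
  "unit_disc \<equiv> ball 0 1"

definition analytic_disc :: "(complex \<Rightarrow> complex) set" where
  "analytic_disc = {f. f holomorphic_on unit_disc \<and> (\<forall>z. z \<notin> unit_disc \<longrightarrow> f z = 0)}"

definition bloch_space :: "(complex \<Rightarrow> complex) set" where
  "bloch_space = {f \<in> analytic_disc.
     bdd_above ((\<lambda>z. (1 - (cmod z)\<^sup>2) * cmod (deriv f z)) ` unit_disc)}"

definition bloch_norm :: "(complex \<Rightarrow> complex) \<Rightarrow> real" where
  "bloch_norm f = cmod (f 0) + (SUP z\<in>unit_disc. (1 - (cmod z)\<^sup>2) * cmod (deriv f z))"

definition dirichlet_space :: "real \<Rightarrow> complex measure \<Rightarrow> (complex \<Rightarrow> complex) set" where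
  "dirichlet_space p \<mu> = {f \<in> analytic_disc. integrable \<mu> (\<lambda>z. cmod (deriv f z) powr p)}"

definition dirichlet_norm :: "real \<Rightarrow> complex measure \<Rightarrow> (complex \<Rightarrow> complex) \<Rightarrow> real" where
  "dirichlet_norm p \<mu> f =
     (cmod (f 0) powr p + (LINT z|\<mu>. cmod (deriv f z) powr p)) powr (1 / p)"

definition composition_operator ::
    "(complex \<Rightarrow> complex) \<Rightarrow> (complex \<Rightarrow> complex) \<Rightarrow> (complex \<Rightarrow> complex)" where
  "composition_operator \<phi> f = (\<lambda>z. if z \<in> unit_disc then f (\<phi> z) else 0)"

end

theory Submission
  imports Defs
begin

text \<open>
  Testing the boundedness of the composition operator on the lacunary polynomials
  \<open>\<Sum>k<n. \<plusminus> z ^ 2 ^ k\<close>, whose Bloch norms are bounded uniformly in \<open>n\<close> and the signs, and averaging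
  over the signs shows that \<open>|\<phi>'| / (1 - |\<phi>|\<^sup>2)\<close> lies in \<open>L\<^sup>p(\<mu>)\<close>: at each point, one of the terms
  \<open>2 ^ k * |\<phi>| ^ (2 ^ k - 1)\<close> is comparable to \<open>1 / (1 - |\<phi>|\<^sup>2)\<close>. By Montel's theorem every sequence in
  the unit ball of the Bloch space has a locally uniformly convergent subsequence, and the
  integrable function above dominates the derivatives of the images, which therefore converge in
  the Dirichlet-type norm.
\<close>

section \<open>Dyadic powers compared with the geometric series\<close>

text \<open>For k >= 1, half of the k-th term consists of 2^(k-1) copies of the smallest among the
  powers r^j with 2^(k-1) <= j < 2^k. These blocks of exponents are disjoint, so together they cost
  at most twice the geometric sum.\<close>

lemma sum_dyadic_powers_le:
  fixes r :: real
  assumes "0 \<le> r" "r \<le> 1"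
  shows "(\<Sum>k<Suc n. 2 ^ k * r ^ (2 ^ k - 1)) \<le> 2 * (\<Sum>j<2 ^ n. r ^ j)"
proof (induction n)
  case 0
  then show ?case by simp
next
  case (Suc n)
  have "2 ^ n * r ^ (2 ^ Suc n - 1) = (\<Sum>j=2 ^ n..<(2::nat) ^ Suc n. r ^ (2 ^ Suc n - 1))"
    by simp
  also have "\<dots> \<le> (\<Sum>j=2 ^ n..<2 ^ Suc n. r ^ j)"
    using assms by (intro sum_mono power_decreasing) auto
  finally have "2 ^ Suc n * r ^ (2 ^ Suc n - 1) \<le> 2 * (\<Sum>j=2 ^ n..<2 ^ Suc n. r ^ j)"
    by simp
  moreover have "(\<Sum>j<2 ^ Suc n. r ^ j) = (\<Sum>j<2 ^ n. r ^ j) + (\<Sum>j=2 ^ n..<2 ^ Suc n. r ^ j)"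
    using sum.atLeastLessThan_concat[of 0 "2 ^ n" "2 ^ Suc n" "\<lambda>j. r ^ j"]
    by (simp add: lessThan_atLeast0)
  ultimately show ?case
    using Suc.IH by (simp add: distrib_left)
qed

lemma sum_dyadic_powers_le_inverse:
  fixes r :: real
  assumes "0 \<le> r" "r < 1"
  shows "(\<Sum>k<n. 2 ^ k * r ^ (2 ^ k - 1)) \<le> 2 / (1 - r)"
proof (cases n)
  case 0
  then show ?thesis using assms by simp
next
  case (Suc m)
  have "(\<Sum>j<2 ^ m. r ^ j) = (1 - r ^ 2 ^ m) / (1 - r)"
    using assms by (simp add: sum_gp_strict)
  also have "\<dots> \<le> 1 / (1 - r)"
    using assms by (intro divide_right_mono) auto
  finally show ?thesis
    using sum_dyadic_powers_le[of r m] assms Suc by simp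
qed

text \<open>
  The exponent is chosen with \<open>2 ^ k\<close> comparable to \<open>1 / (1 - r)\<close>; Bernoulli's inequality then
  keeps the power of \<open>r\<close> away from 0.
\<close>

lemma dyadic_power_ge_inverse:
  fixes r :: real
  assumes "0 \<le> r" "r < 1"
  obtains k :: nat where "1 / (1 - r) \<le> 8 * (2 ^ k * r ^ (2 ^ k - 1))"
proof -
  \<comment> \<open>Because of \<open>Suc k\<close>, failure of \<open>P\<close> at the predecessor
    of \<open>k\<close> reads 2^k (1 - r) <= 1/2, which is what Bernoulli needs to keep the power of
    r above 1/2. \<open>P k\<close> itself gives 1/(1 - r) < 4 * 2^k, and the two factors 2 and 4
    make the constant 8.\<close>
  define P where "P k \<longleftrightarrow> 1 / 2 < 2 ^ Suc k * (1 - r)" for k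
  obtain m where "1 / (1 - r) < 2 ^ m"
    using real_arch_pow[of 2 "1 / (1 - r)"] by auto
  then have "1 < 2 ^ m * (1 - r)"
    using assms by (simp add: field_simps)
  then have "P m"
    by (simp add: P_def)
  define k where "k = (LEAST k. P k)"
  have "P k"
    unfolding k_def using \<open>P m\<close> by (rule LeastI)
  have "1 / 2 \<le> r ^ (2 ^ k - 1)"
  proof (cases k)
    case 0
    then show ?thesis by simp
  next
    case (Suc j)
    have "\<not> P j"
      using not_less_Least[of j P] Suc k_def by simp
    then have "2 ^ k * (1 - r) \<le> 1 / 2"
      by (simp add: P_def Suc)
    moreover have "1 - r \<ge> 0" using assms by simp
    ultimately have "1 / 2 \<le> 1 + real (2 ^ k - 1) * (r - 1)"
      by (simp add: of_nat_diff algebra_simps)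
    also have "\<dots> \<le> (1 + (r - 1)) ^ (2 ^ k - 1)"
      using assms by (intro Bernoulli_inequality) auto
    finally show ?thesis by simp
  qed
  then have "2 ^ k * (1 / 2) \<le> 2 ^ k * r ^ (2 ^ k - 1)"
    by (intro mult_left_mono) auto
  moreover have "1 / (1 - r) \<le> 4 * 2 ^ k"
    using \<open>P k\<close> assms by (simp add: P_def field_simps)
  ultimately have "1 / (1 - r) \<le> 8 * (2 ^ k * r ^ (2 ^ k - 1))"
    by linarith
  then show ?thesis by (rule that)
qed

section \<open>Averages over choices of signs\<close>

text \<open>Coding a choice of signs by a set turns the expectation over independent random signs
  into a finite sum over \<open>Pow I\<close>.\<close>

definition signed :: "nat set \<Rightarrow> nat \<Rightarrow> complex" where
  "signed S k = (if k \<in> S then 1 else -1)"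

lemma norm_signed [simp]: "cmod (signed S k) = 1"
  by (simp add: signed_def)

text \<open>Flipping the sign at k pairs up the choices. The two signed sums of a pair differ by 2
  a(k) up to sign, so one of them has modulus at least |a(k)|. This isolates a single coefficient, a
  weak form of Khinchine's inequality whose constant does not depend on p.\<close>

lemma powr_le_sign_average:
  fixes a :: "nat \<Rightarrow> complex"
  assumes "0 \<le> p" "finite I" "k \<in> I"
  shows "2 ^ card I * cmod (a k) powr p \<le> 2 * (\<Sum>S\<in>Pow I. cmod (\<Sum>j\<in>I. signed S j * a j) powr p)"
proof -
  define F where "F S = (\<Sum>j\<in>I. signed S j * a j)" for S
  define flip where "flip S = sym_diff S {k}" for S
  have inv: "flip (flip S) = S" for S
    by (auto simp: flip_def)
  have bij: "bij_betw flip (Pow I) (Pow I)"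
    using assms(3) by (intro bij_betw_byWitness[where f' = flip]) (auto simp: inv, auto simp: flip_def)
  have pair: "cmod (a k) powr p \<le> cmod (F S) powr p + cmod (F (flip S)) powr p" for S
  proof -
    define R where "R = (\<Sum>j\<in>I - {k}. signed S j * a j)"
    have "(\<Sum>j\<in>I - {k}. signed (flip S) j * a j) = R"
      unfolding R_def by (intro sum.cong) (auto simp: signed_def flip_def)
    then have "F (flip S) = signed (flip S) k * a k + R"
      unfolding F_def using assms by (simp add: sum.remove)
    moreover have "F S = signed S k * a k + R"
      unfolding F_def R_def using assms by (simp add: sum.remove)
    moreover have "signed (flip S) k = - signed S k"
      by (auto simp: signed_def flip_def)
    ultimately have "2 * (signed S k * a k) = F S - F (flip S)"
      by simp
    then have "2 * cmod (a k) = cmod (F S - F (flip S))"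
      by (metis norm_mult norm_numeral norm_signed mult_1)
    also have "\<dots> \<le> cmod (F S) + cmod (F (flip S))"
      by (rule norm_triangle_ineq4)
    finally have "cmod (a k) \<le> cmod (F S) \<or> cmod (a k) \<le> cmod (F (flip S))"
      by linarith
    then show ?thesis
    proof
      assume "cmod (a k) \<le> cmod (F S)"
      then have "cmod (a k) powr p \<le> cmod (F S) powr p"
        using assms by (intro powr_mono2) auto
      then show ?thesis by (smt (verit) powr_ge_zero)
    next
      assume "cmod (a k) \<le> cmod (F (flip S))"
      then have "cmod (a k) powr p \<le> cmod (F (flip S)) powr p"
        using assms by (intro powr_mono2) auto
      then show ?thesis by (smt (verit) powr_ge_zero)
    qed
  qed
  have "2 ^ card I * cmod (a k) powr p = (\<Sum>S\<in>Pow I. cmod (a k) powr p)"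
    using assms by (simp add: card_Pow)
  also have "\<dots> \<le> (\<Sum>S\<in>Pow I. cmod (F S) powr p + cmod (F (flip S)) powr p)"
    by (intro sum_mono pair)
  also have "\<dots> = 2 * (\<Sum>S\<in>Pow I. cmod (F S) powr p)"
    using sum.reindex_bij_betw[OF bij, of "\<lambda>S. cmod (F S) powr p"] by (simp add: sum.distrib)
  finally show ?thesis by (simp add: F_def)
qed

section \<open>Pointwise estimates for Bloch functions\<close>

lemma bloch_norm_ge:
  assumes "f \<in> bloch_space" "z \<in> unit_disc"
  shows "cmod (f 0) + (1 - (cmod z)\<^sup>2) * cmod (deriv f z) \<le> bloch_norm f"
  using assms unfolding bloch_norm_def bloch_space_def by (auto intro!: cSUP_upper)

lemma bloch_normI:
  assumes "f \<in> analytic_disc"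
    and "\<And>z. z \<in> unit_disc \<Longrightarrow> (1 - (cmod z)\<^sup>2) * cmod (deriv f z) \<le> B"
  shows "f \<in> bloch_space" "bloch_norm f \<le> cmod (f 0) + B"
proof -
  show "f \<in> bloch_space"
    using assms by (auto simp: bloch_space_def intro!: bdd_aboveI2)
  show "bloch_norm f \<le> cmod (f 0) + B"
    using assms(2) unfolding bloch_norm_def by (intro add_left_mono cSUP_least) auto
qed

lemma one_minus_cmod_square_pos:
  "z \<in> unit_disc \<Longrightarrow> 0 < 1 - (cmod z)\<^sup>2"
  by (simp add: abs_square_less_1)

lemma bloch_deriv_le:
  assumes "f \<in> bloch_space" "z \<in> unit_disc"
  shows "cmod (deriv f z) \<le> bloch_norm f / (1 - (cmod z)\<^sup>2)"
proof -
  have "(1 - (cmod z)\<^sup>2) * cmod (deriv f z) \<le> bloch_norm f"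
    using bloch_norm_ge[OF assms] norm_ge_zero[of "f 0"] by linarith
  then show ?thesis
    using one_minus_cmod_square_pos[OF assms(2)] by (simp add: field_simps)
qed

text \<open>The derivative bound at w is weakest for |w| = |z|, so the mean value inequality on the
  convex disc \<open>cball 0 (cmod z)\<close> applies with the bound at z. The true growth is
  logarithmic, but Montel's theorem only asks for bounds on compact sets.\<close>

lemma bloch_growth:
  assumes "f \<in> bloch_space" "z \<in> unit_disc"
  shows "cmod (f z) \<le> bloch_norm f * (1 + 1 / (1 - (cmod z)\<^sup>2))"
proof -
  have B: "cmod (f 0) \<le> bloch_norm f" "0 \<le> bloch_norm f"
    using bloch_norm_ge[OF assms(1), of 0] by (auto intro: order_trans[rotated])
  have hol: "f holomorphic_on unit_disc"
    using assms(1) by (simp add: bloch_space_def analytic_disc_def)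
  have sub: "w \<in> unit_disc" "cmod w \<le> cmod z" if "w \<in> cball 0 (cmod z)" for w :: complex
    using that assms(2) by auto
  have "cmod (f z - f 0) \<le> bloch_norm f / (1 - (cmod z)\<^sup>2) * cmod (z - 0)"
  proof (rule field_differentiable_bound[of "cball 0 (cmod z)" f "deriv f"])
    fix w :: complex assume w: "w \<in> cball 0 (cmod z)"
    show "(f has_field_derivative deriv f w) (at w within cball 0 (cmod z))"
      using holomorphic_derivI[OF hol open_ball sub(1)[OF w]] .
    have "bloch_norm f / (1 - (cmod w)\<^sup>2) \<le> bloch_norm f / (1 - (cmod z)\<^sup>2)"
      using B sub[OF w] one_minus_cmod_square_pos assms(2)
      by (intro divide_left_mono diff_left_mono power_mono mult_pos_pos) auto
    then show "cmod (deriv f w) \<le> bloch_norm f / (1 - (cmod z)\<^sup>2)"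
      using bloch_deriv_le[OF assms(1) sub(1)[OF w]] by linarith
  qed auto
  also have "\<dots> \<le> bloch_norm f / (1 - (cmod z)\<^sup>2) * 1"
    using B assms(2) one_minus_cmod_square_pos[OF assms(2)] by (intro mult_left_mono) auto
  finally show ?thesis
    using B(1) norm_triangle_sub[of "f z" "f 0"] by (simp add: algebra_simps)
qed

section \<open>Derivatives inside the disc and lacunary test functions\<close>

text \<open>Representatives are cut off to 0 outside the disc. Since the disc is open, this lets
  derivatives inside be computed from the formula without the cut-off.\<close>

lemma deriv_cong_unit_disc:
  assumes "\<And>w. w \<in> unit_disc \<Longrightarrow> f w = g w" "z \<in> unit_disc"
  shows "deriv f z = deriv g z"
  using assms by (intro deriv_cong_ev) (auto simp: eventually_nhds intro!: exI[of _ unit_disc])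

lemma deriv_composition_operator:
  assumes "f holomorphic_on unit_disc" "\<phi> holomorphic_on unit_disc" "\<phi> ` unit_disc \<subseteq> unit_disc"
    and "z \<in> unit_disc"
  shows "deriv (composition_operator \<phi> f) z = deriv f (\<phi> z) * deriv \<phi> z"
proof -
  have "deriv (composition_operator \<phi> f) z = deriv (f \<circ> \<phi>) z"
    using assms(4) by (intro deriv_cong_unit_disc) (auto simp: composition_operator_def)
  also have "\<dots> = deriv f (\<phi> z) * deriv \<phi> z"
    using assms by (intro deriv_chain) (auto intro!: holomorphic_on_imp_differentiable_at)
  finally show ?thesis .
qed

definition lacunary :: "nat set \<Rightarrow> nat \<Rightarrow> complex \<Rightarrow> complex" where
  "lacunary S n z = (if z \<in> unit_disc then \<Sum>k<n. signed S k * z ^ 2 ^ k else 0)"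

lemma lacunary_analytic: "lacunary S n \<in> analytic_disc"
proof -
  have "lacunary S n holomorphic_on unit_disc \<longleftrightarrow>
      (\<lambda>z. \<Sum>k<n. signed S k * z ^ 2 ^ k) holomorphic_on unit_disc"
    by (intro holomorphic_cong) (auto simp: lacunary_def)
  then show ?thesis
    by (auto simp: analytic_disc_def lacunary_def intro!: holomorphic_intros)
qed

lemma deriv_lacunary:
  assumes "z \<in> unit_disc"
  shows "deriv (lacunary S n) z = (\<Sum>k<n. signed S k * (2 ^ k * z ^ (2 ^ k - 1)))"
proof -
  have "deriv (lacunary S n) z = deriv (\<lambda>z. \<Sum>k<n. signed S k * z ^ 2 ^ k) z"
    using assms by (intro deriv_cong_unit_disc) (auto simp: lacunary_def)
  also have "\<dots> = (\<Sum>k<n. signed S k * (2 ^ k * z ^ (2 ^ k - 1)))"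
    by (rule DERIV_imp_deriv) (auto intro!: derivative_eq_intros sum.cong)
  finally show ?thesis .
qed

text \<open>The dyadic sum bounds the derivative by 2/(1 - |z|), and the weight 1 - |z|^2 = (1 -
  |z|)(1 + |z|) cancels the pole. What matters is that 4 depends neither on \<open>S\<close> nor on
  \<open>n\<close>.\<close>

lemma lacunary_bloch: "lacunary S n \<in> bloch_space" "bloch_norm (lacunary S n) \<le> 4"
proof -
  have *: "(1 - (cmod z)\<^sup>2) * cmod (deriv (lacunary S n) z) \<le> 4" if "z \<in> unit_disc" for z
  proof -
    have z: "cmod z < 1" using that by simp
    have "cmod (deriv (lacunary S n) z) \<le> (\<Sum>k<n. 2 ^ k * cmod z ^ (2 ^ k - 1))"
      unfolding deriv_lacunary[OF that]
      by (rule order_trans[OF norm_sum]) (simp add: norm_mult norm_power)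
    also have "\<dots> \<le> 2 / (1 - cmod z)"
      using z by (intro sum_dyadic_powers_le_inverse) auto
    finally have "(1 - (cmod z)\<^sup>2) * cmod (deriv (lacunary S n) z) \<le> (1 - (cmod z)\<^sup>2) * (2 / (1 - cmod z))"
      using one_minus_cmod_square_pos[OF that] by (intro mult_left_mono) auto
    also have "\<dots> = 2 * (1 + cmod z)"
      using z by (simp add: divide_simps) (simp add: power2_eq_square algebra_simps)
    also have "\<dots> \<le> 4" using z by simp
    finally show ?thesis .
  qed
  show "lacunary S n \<in> bloch_space"
    by (rule bloch_normI(1)[OF lacunary_analytic *])
  \<comment> \<open>All exponents 2^k are positive, so the value at 0 adds nothing to the
    norm.\<close>
  have "lacunary S n 0 = 0"
    by (simp add: lacunary_def power_0_left)
  then show "bloch_norm (lacunary S n) \<le> 4"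
    using bloch_normI(2)[OF lacunary_analytic *] by simp
qed

section \<open>Integrability of the hyperbolic derivative\<close>

lemma measurable_continuous_on_unit_disc:
  assumes "sets \<mu> = sets (restrict_space borel unit_disc)" "continuous_on unit_disc f"
  shows "f \<in> borel_measurable \<mu>"
  using borel_measurable_continuous_on_restrict[OF assms(2)] measurable_cong_sets[OF assms(1) refl]
  by blast

lemma integral_deriv_le_dirichlet_norm:
  assumes "0 < p"
  shows "(LINT z|\<mu>. cmod (deriv f z) powr p) \<le> dirichlet_norm p \<mu> f powr p"
proof -
  have "0 \<le> (LINT z|\<mu>. cmod (deriv f z) powr p)"
    by (intro integral_nonneg_AE) auto
  then show ?thesis
    using assms by (simp add: dirichlet_norm_def powr_powr)
qed

text \<open>This is Fatou's lemma applied to the sign averages \<open>u n\<close>: their integrals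
  have a common bound, while at each point they eventually dominate a fixed multiple of the
  integrand.\<close>

lemma integrable_hyperbolic_derivative:
  assumes p: "1 \<le> p"
    and sets: "sets \<mu> = sets (restrict_space borel unit_disc)"
    and \<phi>: "\<phi> holomorphic_on unit_disc" "\<phi> ` unit_disc \<subseteq> unit_disc"
    and mem: "\<And>f. f \<in> bloch_space \<Longrightarrow> composition_operator \<phi> f \<in> dirichlet_space p \<mu>"
    and C: "\<And>f. f \<in> bloch_space \<Longrightarrow>
        dirichlet_norm p \<mu> (composition_operator \<phi> f) \<le> C * bloch_norm f"
  shows "integrable \<mu> (\<lambda>z. (cmod (deriv \<phi> z) / (1 - (cmod (\<phi> z))\<^sup>2)) powr p)"
proof -
  define h where "h z = (cmod (deriv \<phi> z) / (1 - (cmod (\<phi> z))\<^sup>2)) powr p" for z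
  define D where "D S n z = cmod (deriv (composition_operator \<phi> (lacunary S n)) z) powr p" for S n z
  define u where "u n z = (\<Sum>S\<in>Pow {..<n}. D S n z) / 2 ^ n" for n z
  \<comment> \<open>4 bounds the Bloch norm of the test functions; the absolute value is taken
    because nothing fixes the sign of \<open>C\<close>.\<close>
  define K where "K = (4 * \<bar>C\<bar>) powr p"
  \<comment> \<open>The 8 comes from \<open>dyadic_power_ge_inverse\<close>, raised to the power p,
    and the 2 from \<open>powr_le_sign_average\<close>.\<close>
  define c where "c = 1 / (2 * 8 powr p)"
  have c: "0 < c" by (simp add: c_def)
  have h_nonneg: "0 \<le> h z" for z by (simp add: h_def)
  have space: "space \<mu> = unit_disc"
    using sets_eq_imp_space_eq[OF sets] by (simp add: space_restrict_space)
  have \<phi>': "\<phi> z \<in> unit_disc" if "z \<in> unit_disc" for z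
    using \<phi>(2) that by blast
  have "continuous_on unit_disc (\<lambda>z. cmod (deriv \<phi> z) / (1 - (cmod (\<phi> z))\<^sup>2))"
    using one_minus_cmod_square_pos[OF \<phi>']
    by (intro continuous_intros holomorphic_on_imp_continuous_on holomorphic_deriv \<phi>) force+
  from measurable_continuous_on_unit_disc[OF sets this]
  have meas: "h \<in> borel_measurable \<mu>"
    unfolding h_def by simp
  have D_int: "integrable \<mu> (D S n)" for S n
    using mem[OF lacunary_bloch(1), of S n] by (simp add: D_def[abs_def] dirichlet_space_def)
  have D_le: "integral\<^sup>L \<mu> (D S n) \<le> K" for S n
  proof -
    have "C * bloch_norm (lacunary S n) \<le> 4 * \<bar>C\<bar>"
    proof -
      have "0 \<le> bloch_norm (lacunary S n)"
        using bloch_norm_ge[OF lacunary_bloch(1), of 0 S n]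
          norm_ge_zero[of "lacunary S n 0"] norm_ge_zero[of "deriv (lacunary S n) 0"]
        by (simp del: norm_ge_zero)
      then have "C * bloch_norm (lacunary S n) \<le> \<bar>C\<bar> * bloch_norm (lacunary S n)"
        by (intro mult_right_mono) auto
      also have "\<dots> \<le> \<bar>C\<bar> * 4"
        by (intro mult_left_mono lacunary_bloch) auto
      finally show ?thesis by simp
    qed
    then have le: "dirichlet_norm p \<mu> (composition_operator \<phi> (lacunary S n)) \<le> 4 * \<bar>C\<bar>"
      using C[OF lacunary_bloch(1), of S n] by linarith
    have "integral\<^sup>L \<mu> (D S n) \<le> dirichlet_norm p \<mu> (composition_operator \<phi> (lacunary S n)) powr p"
      using integral_deriv_le_dirichlet_norm[of p] p unfolding D_def by simp
    also have "\<dots> \<le> K"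
      unfolding K_def using p le by (intro powr_mono2) (auto simp: dirichlet_norm_def)
    finally show ?thesis .
  qed
  have u_int: "integrable \<mu> (u n)" for n
    unfolding u_def using D_int by (intro integrable_divide integrable_sum) auto
  have u_le: "integral\<^sup>N \<mu> (\<lambda>z. ennreal (u n z)) \<le> ennreal K" for n
  proof -
    have "integral\<^sup>N \<mu> (\<lambda>z. ennreal (u n z)) = ennreal (integral\<^sup>L \<mu> (u n))"
      by (intro nn_integral_eq_integral u_int AE_I2) (auto simp: u_def D_def intro!: divide_nonneg_nonneg sum_nonneg)
    also have "integral\<^sup>L \<mu> (u n) = (\<Sum>S\<in>Pow {..<n}. integral\<^sup>L \<mu> (D S n)) / 2 ^ n"
      unfolding u_def using D_int by (simp add: Bochner_Integration.integral_sum)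
    also have "\<dots> \<le> (\<Sum>S\<in>Pow {..<n}. K) / 2 ^ n"
      by (intro divide_right_mono sum_mono D_le) auto
    also have "\<dots> = K"
      by (simp add: card_Pow)
    finally show ?thesis
      by (simp add: ennreal_leI)
  qed
  \<comment> \<open>The good index k depends on z and enters the sum only once n > k. The bound is
    therefore eventual at each point, which is enough for a liminf.\<close>
  have lower: "eventually (\<lambda>n. c * h z \<le> u n z) sequentially" if z: "z \<in> unit_disc" for z
  proof -
    have w: "cmod (\<phi> z) < 1" using \<phi>'[OF z] by simp
    obtain k where k: "1 / (1 - cmod (\<phi> z)) \<le> 8 * (2 ^ k * cmod (\<phi> z) ^ (2 ^ k - 1))"
      using dyadic_power_ge_inverse[of "cmod (\<phi> z)"] w by auto
    \<comment> \<open>By the chain rule, \<open>a j\<close> is the factor of the j-th sign in the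
      derivative of the image of \<open>lacunary S n\<close>, whatever \<open>S\<close> is.\<close>
    define a where "a j = 2 ^ j * \<phi> z ^ (2 ^ j - 1) * deriv \<phi> z" for j
    have "1 / (1 - (cmod (\<phi> z))\<^sup>2) \<le> 1 / (1 - cmod (\<phi> z))"
      using w one_minus_cmod_square_pos[OF \<phi>'[OF z]]
      by (intro divide_left_mono) (auto simp: power2_eq_square mult_left_le_one_le)
    then have "1 / (1 - (cmod (\<phi> z))\<^sup>2) * cmod (deriv \<phi> z)
        \<le> 8 * (2 ^ k * cmod (\<phi> z) ^ (2 ^ k - 1)) * cmod (deriv \<phi> z)"
      using k by (intro mult_right_mono) auto
    then have "cmod (deriv \<phi> z) / (1 - (cmod (\<phi> z))\<^sup>2) \<le> 8 * cmod (a k)"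
      by (simp add: a_def norm_mult norm_power)
    then have "h z \<le> (8 * cmod (a k)) powr p"
      unfolding h_def using p one_minus_cmod_square_pos[OF \<phi>'[OF z]]
      by (intro powr_mono2) (auto intro: divide_nonneg_pos)
    then have h_le: "c * h z \<le> cmod (a k) powr p / 2"
      by (simp add: c_def powr_mult field_simps)
    have "c * h z \<le> u n z" if "k < n" for n
    proof -
      have "D S n z = cmod (\<Sum>j<n. signed S j * a j) powr p" for S
      proof -
        have "deriv (composition_operator \<phi> (lacunary S n)) z = deriv (lacunary S n) (\<phi> z) * deriv \<phi> z"
          using lacunary_analytic \<phi> z by (intro deriv_composition_operator) (auto simp: analytic_disc_def)
        also have "\<dots> = (\<Sum>j<n. signed S j * a j)"
          unfolding deriv_lacunary[OF \<phi>'[OF z]] a_def by (simp add: sum_distrib_right mult.assoc)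
        finally show ?thesis by (simp add: D_def)
      qed
      then have "2 ^ n * cmod (a k) powr p \<le> 2 * (\<Sum>S\<in>Pow {..<n}. D S n z)"
        using powr_le_sign_average[of p "{..<n}" k a] p that by simp
      then have "cmod (a k) powr p / 2 \<le> u n z"
        by (simp add: u_def field_simps)
      with h_le show ?thesis by linarith
    qed
    then show ?thesis
      unfolding eventually_sequentially by (intro exI[of _ "Suc k"]) auto
  qed
  have "(\<integral>\<^sup>+z. ennreal (c * h z) \<partial>\<mu>) \<le> (\<integral>\<^sup>+z. liminf (\<lambda>n. ennreal (u n z)) \<partial>\<mu>)"
    by (intro nn_integral_mono Liminf_bounded eventually_mono[OF lower] ennreal_leI) (auto simp: space)
  also have "\<dots> \<le> liminf (\<lambda>n. \<integral>\<^sup>+z. ennreal (u n z) \<partial>\<mu>)"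
    using u_int by (intro nn_integral_liminf) (auto dest: borel_measurable_integrable)
  also have "\<dots> \<le> liminf (\<lambda>n. ennreal K)"
    by (intro Liminf_mono always_eventually allI u_le)
  also have "\<dots> < \<infinity>"
    by (simp add: Liminf_const)
  finally have "integrable \<mu> (\<lambda>z. c * h z)"
    using meas c by (intro integrableI_nonneg borel_measurable_times AE_I2 mult_nonneg_nonneg h_nonneg) auto
  then have "integrable \<mu> h"
    using c by simp
  then show ?thesis
    unfolding h_def .
qed

section \<open>Normal families in the Bloch space\<close>

text \<open>\<open>bloch_growth\<close> makes the sequence locally bounded. Locally uniform
  convergence carries over to derivatives, and the weighted derivative bound then passes to the
  limit at each point, so the limit is again a Bloch function. Pointwise convergence is all that
  dominated convergence will ask for.\<close>

lemma bloch_Montel: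
  fixes f :: "nat \<Rightarrow> complex \<Rightarrow> complex"
  assumes mem: "\<And>n. f n \<in> bloch_space" and B: "\<And>n. bloch_norm (f n) \<le> B"
  obtains g r where "g \<in> bloch_space" "strict_mono (r :: nat \<Rightarrow> nat)"
    "\<And>z. z \<in> unit_disc \<Longrightarrow> (\<lambda>n. f (r n) z) \<longlonglongrightarrow> g z"
    "\<And>z. z \<in> unit_disc \<Longrightarrow> (\<lambda>n. deriv (f (r n)) z) \<longlonglongrightarrow> deriv g z"
proof -
  have hol: "f n holomorphic_on unit_disc" for n
    using mem[of n] by (simp add: bloch_space_def analytic_disc_def)
  have bounded: "\<exists>L. \<forall>h\<in>range f. \<forall>z\<in>K. cmod (h z) \<le> L" if K: "compact K" "K \<subseteq> unit_disc" for K
  proof -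
    have pos: "0 < 1 - (cmod z)\<^sup>2" if "z \<in> K" for z
      using that K one_minus_cmod_square_pos by blast
    have "continuous_on K (\<lambda>z. B * (1 + 1 / (1 - (cmod z)\<^sup>2)))"
      using pos by (intro continuous_intros) force
    then have "bounded ((\<lambda>z. B * (1 + 1 / (1 - (cmod z)\<^sup>2))) ` K)"
      using K(1) by (intro compact_imp_bounded compact_continuous_image)
    then obtain L where L: "\<And>z. z \<in> K \<Longrightarrow> \<bar>B * (1 + 1 / (1 - (cmod z)\<^sup>2))\<bar> \<le> L"
      by (auto simp: bounded_iff)
    have "cmod (f n z) \<le> L" if "z \<in> K" for n z
    proof -
      have "cmod (f n z) \<le> bloch_norm (f n) * (1 + 1 / (1 - (cmod z)\<^sup>2))"
        using that K by (intro bloch_growth mem) auto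
      also have "\<dots> \<le> B * (1 + 1 / (1 - (cmod z)\<^sup>2))"
        using B[of n] pos[OF that] by (intro mult_right_mono) auto
      also have "\<dots> \<le> L"
        using L[OF that] by linarith
      finally show ?thesis .
    qed
    then show ?thesis by blast
  qed
  obtain g0 r where g0: "g0 holomorphic_on unit_disc" and r: "strict_mono (r :: nat \<Rightarrow> nat)"
    and lim: "\<And>z. z \<in> unit_disc \<Longrightarrow> (\<lambda>n. f (r n) z) \<longlonglongrightarrow> g0 z"
    and ulim: "\<And>K. compact K \<Longrightarrow> K \<subseteq> unit_disc \<Longrightarrow> uniform_limit K (f \<circ> r) g0 sequentially"
    by (rule Montel[of unit_disc "range f" f]) (use hol bounded in auto)
  \<comment> \<open>Montel's theorem says nothing about the limit outside the disc, where a
    representative has to vanish.\<close>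
  define g where "g z = (if z \<in> unit_disc then g0 z else 0)" for z
  have "g holomorphic_on unit_disc"
    using g0 by (subst holomorphic_cong[of _ unit_disc _ g0]) (auto simp: g_def)
  then have g: "g \<in> analytic_disc"
    by (simp add: analytic_disc_def g_def)
  have dlim: "(\<lambda>n. deriv (f (r n)) z) \<longlonglongrightarrow> deriv g z" if z: "z \<in> unit_disc" for z
  proof -
    \<comment> \<open>\<open>ulim\<close> is available on compact sets only, so a closed disc is
      fixed first and the limit of derivatives is taken on its interior.\<close>
    obtain d where d: "0 < d" "cball z d \<subseteq> unit_disc"
      using z open_ball[of 0 1] unfolding open_contains_cball by metis
    have "uniform_limit (ball z d) (f \<circ> r) g0 sequentially"
      using ulim[OF compact_cball d(2)] ball_subset_cball uniform_limit_on_subset by blast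
    then have "(\<lambda>n. deriv ((f \<circ> r) n) z) \<longlonglongrightarrow> deriv g0 z"
    proof (rule deriv_complex_uniform_limit)
      have "f (r n) holomorphic_on ball z d" for n
        using hol d(2) ball_subset_cball by (meson holomorphic_on_subset order_trans)
      then show "\<forall>\<^sub>F n in sequentially. (f \<circ> r) n holomorphic_on ball z d"
        by simp
    qed (use d in auto)
    moreover have "deriv g z = deriv g0 z"
      using z by (intro deriv_cong_unit_disc) (auto simp: g_def)
    ultimately show ?thesis by simp
  qed
  have "(1 - (cmod z)\<^sup>2) * cmod (deriv g z) \<le> B" if z: "z \<in> unit_disc" for z
  proof (rule LIMSEQ_le_const2)
    show "(\<lambda>n. (1 - (cmod z)\<^sup>2) * cmod (deriv (f (r n)) z)) \<longlonglongrightarrow> (1 - (cmod z)\<^sup>2) * cmod (deriv g z)"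
      by (intro tendsto_intros dlim z)
    have "(1 - (cmod z)\<^sup>2) * cmod (deriv (f n) z) \<le> B" for n
      using bloch_norm_ge[OF mem z, of n] B[of n] norm_ge_zero[of "f n 0"] by linarith
    then show "\<exists>N. \<forall>n\<ge>N. (1 - (cmod z)\<^sup>2) * cmod (deriv (f (r n)) z) \<le> B"
      by blast
  qed
  then have "g \<in> bloch_space"
    by (rule bloch_normI(1)[OF g])
  then show ?thesis
    using r lim dlim by (intro that[of g r]) (auto simp: g_def)
qed

section \<open>Convergence of the images in the Dirichlet-type norm\<close>

lemma composition_operator_analytic:
  assumes "f \<in> analytic_disc" "\<phi> holomorphic_on unit_disc" "\<phi> ` unit_disc \<subseteq> unit_disc"
  shows "composition_operator \<phi> f \<in> analytic_disc"
proof -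
  have "(f \<circ> \<phi>) holomorphic_on unit_disc"
    using assms by (auto simp: analytic_disc_def intro: holomorphic_on_compose_gen)
  then have "composition_operator \<phi> f holomorphic_on unit_disc"
    by (subst holomorphic_cong[of _ unit_disc _ "f \<circ> \<phi>"]) (auto simp: composition_operator_def)
  then show ?thesis
    by (simp add: analytic_disc_def composition_operator_def)
qed

text \<open>The Bloch bounds for \<open>f n\<close> and \<open>g\<close> at the point \<phi>(z) give
  |(F n)'| <= L |\<phi>'| / (1 - |\<phi>|^2), uniformly in n. The p-th power of the right side is
  integrable by \<open>int\<close>, so dominated convergence applies.\<close>

lemma dirichlet_norm_diff_tendsto_0:
  assumes p: "1 \<le> p"
    and sets: "sets \<mu> = sets (restrict_space borel unit_disc)"
    and \<phi>: "\<phi> holomorphic_on unit_disc" "\<phi> ` unit_disc \<subseteq> unit_disc"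
    and int: "integrable \<mu> (\<lambda>z. (cmod (deriv \<phi> z) / (1 - (cmod (\<phi> z))\<^sup>2)) powr p)"
    and f: "\<And>n. f n \<in> bloch_space" "\<And>n. bloch_norm (f n) \<le> B" and g: "g \<in> bloch_space"
    and lim: "\<And>z. z \<in> unit_disc \<Longrightarrow> (\<lambda>n. f n z) \<longlonglongrightarrow> g z"
    and dlim: "\<And>z. z \<in> unit_disc \<Longrightarrow> (\<lambda>n. deriv (f n) z) \<longlonglongrightarrow> deriv g z"
  shows "(\<lambda>n. dirichlet_norm p \<mu> (composition_operator \<phi> (f n) - composition_operator \<phi> g)) \<longlonglongrightarrow> 0"
proof -
  define F where "F n = composition_operator \<phi> (f n) - composition_operator \<phi> g" for n
  define L where "L = B + bloch_norm g"
  have space: "space \<mu> = unit_disc"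
    using sets_eq_imp_space_eq[OF sets] by (simp add: space_restrict_space)
  have \<phi>': "\<phi> z \<in> unit_disc" if "z \<in> unit_disc" for z
    using \<phi>(2) that by blast
  have hol: "h holomorphic_on unit_disc" "composition_operator \<phi> h holomorphic_on unit_disc"
    if "h \<in> bloch_space" for h
    using that composition_operator_analytic[OF _ \<phi>] by (auto simp: bloch_space_def analytic_disc_def)
  have deriv_F: "deriv (F n) z = (deriv (f n) (\<phi> z) - deriv g (\<phi> z)) * deriv \<phi> z" if z: "z \<in> unit_disc" for n z
  proof -
    have "deriv (F n) z = deriv (composition_operator \<phi> (f n)) z - deriv (composition_operator \<phi> g) z"
      unfolding F_def fun_diff_def using hol f(1) g z
      by (intro deriv_diff) (auto intro!: holomorphic_on_imp_differentiable_at[of _ unit_disc])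
    then show ?thesis
      using hol f(1) g z \<phi> by (simp add: deriv_composition_operator left_diff_distrib)
  qed
  \<comment> \<open>With base tending to 0, continuity of \<open>powr\<close> rests on the exponent
    being positive.\<close>
  have powr_lim: "(\<lambda>n. x n powr p) \<longlonglongrightarrow> 0" if "x \<longlonglongrightarrow> 0" "\<And>n. 0 \<le> x n" for x
    using tendsto_powr'[OF that(1) tendsto_const, of p] that(2) p by simp
  have "(\<lambda>n. LINT z|\<mu>. cmod (deriv (F n) z) powr p) \<longlonglongrightarrow> (LINT z|\<mu>. 0)"
  proof (rule integral_dominated_convergence)
    show "integrable \<mu> (\<lambda>z. L powr p * (cmod (deriv \<phi> z) / (1 - (cmod (\<phi> z))\<^sup>2)) powr p)"
      using int by simp
    show "(\<lambda>z. cmod (deriv (F n) z) powr p) \<in> borel_measurable \<mu>" for n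
    proof -
      have "F n holomorphic_on unit_disc"
        unfolding F_def fun_diff_def using hol f(1) g by (intro holomorphic_intros) auto
      then have "continuous_on unit_disc (\<lambda>z. cmod (deriv (F n) z))"
        by (intro continuous_intros holomorphic_on_imp_continuous_on holomorphic_deriv) auto
      from measurable_continuous_on_unit_disc[OF sets this] show ?thesis
        by simp
    qed
    show "AE z in \<mu>. (\<lambda>n. cmod (deriv (F n) z) powr p) \<longlonglongrightarrow> 0"
    proof (intro AE_I2 powr_lim)
      fix z assume "z \<in> space \<mu>"
      then have z: "z \<in> unit_disc" by (simp add: space)
      have "(\<lambda>n. cmod ((deriv (f n) (\<phi> z) - deriv g (\<phi> z)) * deriv \<phi> z))
          \<longlonglongrightarrow> cmod ((deriv g (\<phi> z) - deriv g (\<phi> z)) * deriv \<phi> z)"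
        by (intro tendsto_intros dlim \<phi>' z)
      then show "(\<lambda>n. cmod (deriv (F n) z)) \<longlonglongrightarrow> 0"
        by (simp add: deriv_F[OF z])
    qed auto
    show "AE z in \<mu>. norm (cmod (deriv (F n) z) powr p)
        \<le> L powr p * (cmod (deriv \<phi> z) / (1 - (cmod (\<phi> z))\<^sup>2)) powr p" for n
    proof (intro AE_I2)
      fix z assume "z \<in> space \<mu>"
      then have z: "z \<in> unit_disc" by (simp add: space)
      define s where "s = 1 - (cmod (\<phi> z))\<^sup>2"
      have s: "0 < s"
        unfolding s_def using one_minus_cmod_square_pos[OF \<phi>'[OF z]] .
      have "cmod (deriv (f n) (\<phi> z) - deriv g (\<phi> z)) \<le> bloch_norm (f n) / s + bloch_norm g / s"
        using bloch_deriv_le[OF f(1) \<phi>'[OF z], of n] bloch_deriv_le[OF g \<phi>'[OF z]]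
          norm_triangle_ineq4[of "deriv (f n) (\<phi> z)" "deriv g (\<phi> z)"] unfolding s_def by linarith
      also have "\<dots> \<le> L / s"
        using f(2)[of n] s by (simp add: L_def add_divide_distrib divide_right_mono)
      finally have le: "cmod (deriv (f n) (\<phi> z) - deriv g (\<phi> z)) \<le> L / s" .
      then have "0 \<le> L / s"
        using norm_ge_zero order_trans by blast
      then have L: "0 \<le> L"
        using s by (simp add: zero_le_divide_iff)
      have "cmod (deriv (F n) z) \<le> L / s * cmod (deriv \<phi> z)"
        unfolding deriv_F[OF z] norm_mult using le by (rule mult_right_mono) auto
      then have "cmod (deriv (F n) z) powr p \<le> (L * (cmod (deriv \<phi> z) / s)) powr p"
        using p by (intro powr_mono2) auto
      also have "\<dots> = L powr p * (cmod (deriv \<phi> z) / s) powr p"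
        using s L by (intro powr_mult)
      finally show "norm (cmod (deriv (F n) z) powr p) \<le> L powr p * (cmod (deriv \<phi> z) / (1 - (cmod (\<phi> z))\<^sup>2)) powr p"
        by (simp add: s_def)
    qed
  qed auto
  \<comment> \<open>The point term of the norm involves the values at \<phi>(0), so convergence of
    the functions themselves enters here, not only that of their derivatives.\<close>
  moreover have "(\<lambda>n. cmod (F n 0) powr p) \<longlonglongrightarrow> 0"
  proof (intro powr_lim)
    have "(\<lambda>n. cmod (f n (\<phi> 0) - g (\<phi> 0))) \<longlonglongrightarrow> cmod (g (\<phi> 0) - g (\<phi> 0))"
      by (intro tendsto_intros lim \<phi>') auto
    then show "(\<lambda>n. cmod (F n 0)) \<longlonglongrightarrow> 0"
      by (simp add: F_def composition_operator_def)
  qed auto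
  ultimately have "(\<lambda>n. cmod (F n 0) powr p + (LINT z|\<mu>. cmod (deriv (F n) z) powr p)) \<longlonglongrightarrow> 0"
    using tendsto_add[of _ 0 sequentially _ 0] by simp
  from tendsto_powr'[OF this tendsto_const, of "1 / p"]
  show ?thesis
    using p by (simp add: F_def[symmetric] dirichlet_norm_def[abs_def] integral_nonneg_AE)
qed

section \<open>Compactness of the composition operator\<close>

theorem theorem2:
  fixes p :: real and \<mu> :: "complex measure" and \<phi> :: "complex \<Rightarrow> complex"
  assumes "1 \<le> p"
    and "sets \<mu> = sets (restrict_space borel unit_disc)"
    and "banach_space_on (dirichlet_space p \<mu>) (dirichlet_norm p \<mu>)"
    and "\<And>K. compact K \<Longrightarrow> K \<subseteq> unit_disc \<Longrightarrow>
           \<exists>C. \<forall>\<zeta>\<in>K. \<forall>f\<in>dirichlet_space p \<mu>. cmod (f \<zeta>) \<le> C * dirichlet_norm p \<mu> f"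
    and "\<phi> holomorphic_on unit_disc" and "\<phi> ` unit_disc \<subseteq> unit_disc"
    and "bounded_operator_on bloch_space bloch_norm
           (dirichlet_space p \<mu>) (dirichlet_norm p \<mu>) (composition_operator \<phi>)"
  shows "compact_operator_on bloch_space bloch_norm
           (dirichlet_space p \<mu>) (dirichlet_norm p \<mu>) (composition_operator \<phi>)"
proof -
  let ?W = "dirichlet_space p \<mu>" and ?M = "dirichlet_norm p \<mu>" and ?T = "composition_operator \<phi>"
  let ?B = "{f \<in> bloch_space. bloch_norm f \<le> 1}"
  from assms(7) obtain C where lin: "linear_operator_on bloch_space ?W ?T"
    and C: "\<And>f. f \<in> bloch_space \<Longrightarrow> ?M (?T f) \<le> C * bloch_norm f"
    by (auto simp: bounded_operator_on_def)
  have mem: "?T f \<in> ?W" if "f \<in> bloch_space" for f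
    using lin that by (auto simp: linear_operator_on_def)
  note int = integrable_hyperbolic_derivative[OF assms(1,2,5,6) mem C]
  from assms(3) have "normed_space_on ?W ?M"
    and complete: "Metric_space.mcomplete ?W (norm_dist ?W ?M)"
    by (auto simp: banach_space_on_def)
  then interpret Metric_space ?W "norm_dist ?W ?M"
    by (intro Metric_space_norm_dist)
  \<comment> \<open>In a complete metric space a set has compact closure exactly when it is totally
    bounded, that is, when each of its sequences has a Cauchy subsequence. The subsequence is
    extracted among preimages in the Bloch unit ball.\<close>
  have "mtotally_bounded (?T ` ?B)"
    unfolding mtotally_bounded_sequentially
  proof (intro conjI strip)
    show "?T ` ?B \<subseteq> ?W"
      using mem by auto
    fix \<sigma> :: "nat \<Rightarrow> complex \<Rightarrow> complex"
    assume "range \<sigma> \<subseteq> ?T ` ?B"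
    then have "\<forall>n. \<exists>f\<in>?B. \<sigma> n = ?T f"
      by blast
    then obtain f where f: "\<And>n. f n \<in> bloch_space" "\<And>n. bloch_norm (f n) \<le> 1"
      and \<sigma>: "\<And>n. \<sigma> n = ?T (f n)"
      by (metis (mono_tags, lifting) mem_Collect_eq)
    obtain g r where g: "g \<in> bloch_space" and r: "strict_mono (r :: nat \<Rightarrow> nat)"
      and lim: "\<And>z. z \<in> unit_disc \<Longrightarrow> (\<lambda>n. f (r n) z) \<longlonglongrightarrow> g z"
        "\<And>z. z \<in> unit_disc \<Longrightarrow> (\<lambda>n. deriv (f (r n)) z) \<longlonglongrightarrow> deriv g z"
      using bloch_Montel[of f 1] f by metis
    have "(\<lambda>n. ?M (?T (f (r n)) - ?T g)) \<longlonglongrightarrow> 0"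
      by (rule dirichlet_norm_diff_tendsto_0[OF assms(1,2,5,6) int f g lim])
    then have "limitin mtopology (\<sigma> \<circ> r) (?T g) sequentially"
      using f(1) g mem by (simp add: limitin_metric_dist_null \<sigma> norm_dist_def)
    then have "MCauchy (\<sigma> \<circ> r)"
      using f(1) mem by (intro convergent_imp_MCauchy) (auto simp: \<sigma>)
    with r show "\<exists>r. strict_mono r \<and> MCauchy (\<sigma> \<circ> r)"
      by blast
  qed
  then show ?thesis
    using lin mtotally_bounded_eq_compact_closure_of[OF complete]
    by (simp add: compact_operator_on_def Let_def)
qed

end
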